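(* Let $n\geq 2$ and $r\geq 3n+2$ be integers and set $n_1 = r(3n+2)+3$, $n_2 = r(3n+2)+6$, $n_3 = r(3n+2)+3n+4$, $n_4 = r(3n+2)+3n+5$. Let $S = \langle n_1,n_2,n_3,n_4\rangle$ be the numerical semigroup generated by these integers. Then $k[[S]]$ does not have maximal reduced type and does not have minimal reduced type.
   Context: $\mathbb{N}$ denotes the non-negative integers. A numerical semigroup is a submonoid $S$ of $(\mathbb{N},+)$ with $\mathbb{N}\setminus S$ finite; $\langle n_1,\ldots,n_e\rangle$ is the submonoid of $\mathbb{N}$ generated by $n_1,\ldots,n_e$. The multiplicity $m(S)$ is the smallest nonzero element of $S$, and the Frobenius number $\mathrm{F}(S)$ is the largest integer not in $S$. A pseudo-Frobenius number of $S$ is an integer $f\notin S$ with $f+s\in S$ for all $s\in S\setminus\{0\}$; $\mathrm{PF}(S)$ is the set of these. Let $k$ be an algebraically closed field of characteristic zero. For $S$ with minimal generators $n_1,\ldots,n_e$, $R=k[[S]] := k[[t^{n_1},\ldots,t^{n_e}]]\subseteq k[[t]]$. The type, $\mathrm{type}(k[[S]])$, is the Cohen-Macaulay type of $k[[S]]$, which equals $|\mathrm{PF}(S)|$. With $K$ the quotient field of $R$, $\bar R$ its integral closure in $K$ and $\mathfrak{C}=(R:_K\bar R)$ the conductor ideal, the reduced type is $s(R)=\dim_k \frac{\mathfrak{C}+xR}{xR}$ with $x=t^{m(S)}$; it satisfies $1\le s(R)\le \mathrm{type}(R)$, and it is known to equal the number of integers in $[\mathrm{F}(S)-m(S)+1,\mathrm{F}(S)]\setminus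 S$. $R$ has maximal reduced type if $s(R)=\mathrm{type}(R)$, and minimal reduced type if $s(R)=1$. *)

theory Defs
  imports
    "HOL-Computational_Algebra.Formal_Laurent_Series"
    "HOL-Algebra.Algebraic_Closure_Type"
begin

section \<open>Numerical semigroups\<close>

definition submonoid_nat :: "nat set \<Rightarrow> bool" where
  "submonoid_nat S \<longleftrightarrow> 0 \<in> S \<and> (\<forall>a\<in>S. \<forall>b\<in>S. a + b \<in> S)"

definition numerical_semigroup :: "nat set \<Rightarrow> bool" where
  "numerical_semigroup S \<longleftrightarrow> submonoid_nat S \<and> finite (- S)"

definition generated_monoid :: "nat set \<Rightarrow> nat set" where
  "generated_monoid A = submonoid_nat hull A"

definition multiplicity_sg :: "nat set \<Rightarrow> nat" where
  "multiplicity_sg S = (LEAST s. s \<in> S \<and> s \<noteq> 0)"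

definition minimal_generators :: "nat set \<Rightarrow> nat set" where
  "minimal_generators S = {s \<in> S - {0}. \<forall>a\<in>S - {0}. \<forall>b\<in>S - {0}. s \<noteq> a + b}"

lemma submonoid_generated_monoid: "submonoid_nat (generated_monoid A)"
  unfolding generated_monoid_def by (rule hull_in) (auto simp: submonoid_nat_def)

lemma generators_subset: "A \<subseteq> generated_monoid A"
  unfolding generated_monoid_def by (rule hull_subset)

lemma submonoid_nat_mult:
  assumes "submonoid_nat S" "a \<in> S"
  shows "q * a \<in> S"
  using assms by (induction q) (auto simp: submonoid_nat_def)

lemma numerical_semigroup_generated:
  assumes "a \<in> A" "Suc a \<in> A"
  shows "numerical_semigroup (generated_monoid A)"
proof -
  let ?S = "generated_monoid A"
  have S: "submonoid_nat ?S" by (rule submonoid_generated_monoid)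
  have mem: "a \<in> ?S" "Suc a \<in> ?S" using assms generators_subset by blast+
  have big: "N \<in> ?S" if "a * a \<le> N" for N
  proof (cases "a = 0")
    case True
    then show ?thesis using submonoid_nat_mult[OF S mem(2), of N] by simp
  next
    case False
    define q s where "q = N div a" and "s = N mod a"
    have "s < a" using False by (simp add: s_def)
    have "a \<le> q" unfolding q_def using that False
      by (metis div_le_mono nonzero_mult_div_cancel_right)
    have "N = q * a + s" by (simp add: q_def s_def)
    also have "\<dots> = (q - s) * a + s * Suc a"
    proof -
      obtain d where "q = s + d" using \<open>s < a\<close> \<open>a \<le> q\<close> le_Suc_ex[of s q] by auto
      then show ?thesis by (simp add: algebra_simps)
    qed
    finally have N: "N = (q - s) * a + s * Suc a" .
    show ?thesis
      unfolding N using S submonoid_nat_mult[OF S mem(1)] submonoid_nat_mult[OF S mem(2)]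
      unfolding submonoid_nat_def by blast
  qed
  have "- ?S \<subseteq> {..< a * a}" using big by (force simp: not_less[symmetric])
  then show ?thesis using S finite_subset by (auto simp: numerical_semigroup_def)
qed

lemma sum_in_submonoid_nat:
  assumes "submonoid_nat S" "finite A" "A \<subseteq> S"
  shows "(\<Sum>s\<in>A. a s * s) \<in> S"
  using assms(2,3)
proof (induction A rule: finite_induct)
  case empty
  then show ?case using assms(1) by (simp add: submonoid_nat_def)
next
  case (insert x F)
  then show ?case
    using submonoid_nat_mult[OF assms(1), of x "a x"] assms(1) by (simp add: submonoid_nat_def)
qed

lemma finite_minimal_generators:
  assumes "numerical_semigroup S"
  shows "finite (minimal_generators S)"
proof -
  obtain c where c: "\<And>x. x \<notin> S \<Longrightarrow> x < c"
    using assms unfolding numerical_semigroup_def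
    by (metis ComplI finite_nat_set_iff_bounded)
  have "s < 2 * Suc c" if "s \<in> minimal_generators S" for s
  proof (rule ccontr)
    assume "\<not> s < 2 * Suc c"
    then have "Suc c \<in> S - {0}" "s - Suc c \<in> S - {0}" "s = Suc c + (s - Suc c)"
      using c[of "Suc c"] c[of "s - Suc c"] by fastforce+
    then show False using that unfolding minimal_generators_def by blast
  qed
  then show ?thesis using finite_nat_set_iff_bounded by blast
qed


section \<open>The semigroup ring\<close>

text \<open>For a finite set \<open>A\<close> of positive integers, \<open>power_series_subring A\<close> is the image of the
  substitution homomorphism \<open>k[[X\<^sub>s : s \<in> A]] \<rightarrow> k[[t]]\<close>, \<open>X\<^sub>s \<mapsto> t\<^sup>s\<close>. A multivariate power series
  is given by its coefficient function \<open>c\<close> on exponent vectors \<open>a\<close>, and the monomial with exponent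
  vector \<open>a\<close> is sent to \<open>t\<close> to the power \<open>\<Sum>s\<in>A. a s * s\<close>.\<close>

definition exponent_vectors :: "nat set \<Rightarrow> nat \<Rightarrow> (nat \<Rightarrow> nat) set" where
  "exponent_vectors A m = {a. (\<forall>s. s \<notin> A \<longrightarrow> a s = 0) \<and> (\<Sum>s\<in>A. a s * s) = m}"

definition power_series_subring :: "nat set \<Rightarrow> 'k::field fps set" where
  "power_series_subring A =
     {f. \<exists>c :: (nat \<Rightarrow> nat) \<Rightarrow> 'k. \<forall>m. fps_nth f m = (\<Sum>a\<in>exponent_vectors A m. c a)}"

lemma exponent_vectors_nonempty_iff:
  assumes "numerical_semigroup S"
  shows "exponent_vectors (minimal_generators S) m \<noteq> {} \<longleftrightarrow> m \<in> S"
proof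
  have S: "submonoid_nat S" using assms by (simp add: numerical_semigroup_def)
  have fin: "finite (minimal_generators S)" by (rule finite_minimal_generators[OF assms])
  {
    assume "exponent_vectors (minimal_generators S) m \<noteq> {}"
    then show "m \<in> S"
      using sum_in_submonoid_nat[OF S fin]
      by (auto simp: exponent_vectors_def minimal_generators_def)
  next
    assume "m \<in> S"
    then show "exponent_vectors (minimal_generators S) m \<noteq> {}"
    proof (induction m rule: less_induct)
      case (less m)
      consider "m = 0" | "m \<in> minimal_generators S"
        | x y where "x \<in> S - {0}" "y \<in> S - {0}" "m = x + y"
        using less.prems unfolding minimal_generators_def by blast
      then show ?case
      proof cases
        case 1
        then have "(\<lambda>_. 0) \<in> exponent_vectors (minimal_generators S) m"
          by (simp add: exponent_vectors_def)
        then show ?thesis by blast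
      next
        case 2
        then have "(\<lambda>s. if s = m then 1 else 0) \<in> exponent_vectors (minimal_generators S) m"
          using fin by (auto simp: exponent_vectors_def if_distrib[of "\<lambda>c. c * _"] cong: if_cong)
        then show ?thesis by blast
      next
        case 3
        then obtain a b where "a \<in> exponent_vectors (minimal_generators S) x"
          "b \<in> exponent_vectors (minimal_generators S) y"
          using less.IH[of x] less.IH[of y] by auto
        then have "(\<lambda>s. a s + b s) \<in> exponent_vectors (minimal_generators S) m"
          using 3 by (auto simp: exponent_vectors_def distrib_right sum.distrib)
        then show ?thesis by blast
      qed
    qed
  }
qed

lemma finite_exponent_vectors:
  assumes "finite A" "0 \<notin> A"
  shows "finite (exponent_vectors A m)"
proof -
  have "a s \<le> m" if "a \<in> exponent_vectors A m" for a s
  proof (cases "s \<in> A")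
    case True
    then have "a s * s \<le> m"
      using that assms member_le_sum[of s A "\<lambda>s. a s * s"] by (auto simp: exponent_vectors_def)
    moreover have "a s * 1 \<le> a s * s"
      using True assms by (intro mult_le_mono2) (cases s, auto)
    ultimately show ?thesis by linarith
  qed (use that in \<open>auto simp: exponent_vectors_def\<close>)
  then have "exponent_vectors A m \<subseteq> {a. \<forall>s. (s \<in> A \<longrightarrow> a s \<in> {..m}) \<and> (s \<notin> A \<longrightarrow> a s = 0)}"
    by (auto simp: exponent_vectors_def)
  then show ?thesis
    using finite_set_of_finite_funs[OF assms(1), of "{..m}" 0] finite_subset by blast
qed

lemma power_series_subring_minimal_generators:
  assumes "numerical_semigroup S"
  shows "power_series_subring (minimal_generators S) =
           {f :: 'k::field fps. \<forall>m. fps_nth f m \<noteq> 0 \<longrightarrow> m \<in> S}"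
proof (intro equalityI subsetI)
  let ?E = "exponent_vectors (minimal_generators S)"
  fix f :: "'k fps"
  {
    assume "f \<in> power_series_subring (minimal_generators S)"
    then obtain c where c: "\<And>m. fps_nth f m = (\<Sum>a\<in>?E m. c a)"
      by (auto simp: power_series_subring_def)
    have "m \<in> S" if "fps_nth f m \<noteq> 0" for m
      using that c[of m] exponent_vectors_nonempty_iff[OF assms, of m] by force
    then show "f \<in> {f. \<forall>m. fps_nth f m \<noteq> 0 \<longrightarrow> m \<in> S}" by blast
  next
    assume f: "f \<in> {f. \<forall>m. fps_nth f m \<noteq> 0 \<longrightarrow> m \<in> S}"
    define v where "v m = (SOME a. a \<in> ?E m)" for m
    define c where "c a = (let m = \<Sum>s\<in>minimal_generators S. a s * s
                           in if a = v m then fps_nth f m else 0)" for a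
    have "fps_nth f m = (\<Sum>a\<in>?E m. c a)" for m
    proof -
      have fin: "finite (?E m)"
        using finite_exponent_vectors finite_minimal_generators[OF assms]
        by (simp add: minimal_generators_def)
      have "(\<Sum>a\<in>?E m. c a) = (\<Sum>a\<in>?E m. if a = v m then fps_nth f m else 0)"
        by (rule sum.cong) (auto simp: c_def exponent_vectors_def)
      also have "\<dots> = (if v m \<in> ?E m then fps_nth f m else 0)"
        using fin by simp
      also have "\<dots> = fps_nth f m"
        using f exponent_vectors_nonempty_iff[OF assms, of m] some_in_eq[of "?E m"]
        by (auto simp: v_def)
      finally show ?thesis by simp
    qed
    then show "f \<in> power_series_subring (minimal_generators S)"
      by (auto simp: power_series_subring_def)
  }
qed

text \<open>\<open>k[[S]]\<close>, regarded as a subring of the field \<open>k((t))\<close>.\<close>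

definition semigroup_ring :: "nat set \<Rightarrow> 'k::field fls set" where
  "semigroup_ring S = fps_to_fls ` power_series_subring (minimal_generators S)"


section \<open>Quotient field, integral closure, conductor\<close>

text \<open>Throughout, \<open>R\<close> is (the carrier of) a subring of an ambient field.\<close>

definition quotient_field :: "'a::field set \<Rightarrow> 'a set" where
  "quotient_field R = {a / b | a b. a \<in> R \<and> b \<in> R \<and> b \<noteq> 0}"

definition integral_closure :: "'a::field set \<Rightarrow> 'a set" where
  "integral_closure R =
     {z \<in> quotient_field R.
        \<exists>p. lead_coeff p = 1 \<and> (\<forall>i. Polynomial.coeff p i \<in> R) \<and> poly p z = 0}"

definition conductor :: "'a::field set \<Rightarrow> 'a set" where
  "conductor R = {z \<in> quotient_field R. \<forall>y\<in>integral_closure R. z * y \<in> R}"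


section \<open>Type and reduced type\<close>

definition ring_on :: "'a::field set \<Rightarrow> 'a ring" where
  "ring_on R = ring_of_type_algebra\<lparr>carrier := R\<rparr>"

definition residue_ring_mod :: "'a::field set \<Rightarrow> 'a \<Rightarrow> 'a set ring" where
  "residue_ring_mod R x = ring_on R Quot (PIdl\<^bsub>ring_on R\<^esub> x)"

definition residue_class :: "'a::field set \<Rightarrow> 'a \<Rightarrow> 'a \<Rightarrow> 'a set" where
  "residue_class R x f = (PIdl\<^bsub>ring_on R\<^esub> x) +>\<^bsub>ring_on R\<^esub> f"

text \<open>The vector space dimension over \<open>k\<close> of a subspace \<open>E\<close> of \<open>R/xR\<close>; here \<open>k\<close> acts through its
  image in \<open>R/xR\<close>.\<close>

definition dim_mod :: "'k::field fls set \<Rightarrow> 'k fls \<Rightarrow> 'k fls set set \<Rightarrow> nat" where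
  "dim_mod R x E =
     ring.dim (residue_ring_mod R x) (range (\<lambda>c. residue_class R x (fls_const c))) E"

text \<open>The maximal ideal of a local ring \<open>R\<close>.\<close>

definition nonunits :: "'a::field set \<Rightarrow> 'a set" where
  "nonunits R = R - Units (ring_on R)"

definition socle_mod :: "'a::field set \<Rightarrow> 'a \<Rightarrow> 'a set set" where
  "socle_mod R x =
     {u \<in> carrier (residue_ring_mod R x).
        \<forall>a\<in>nonunits R.
          residue_class R x a \<otimes>\<^bsub>residue_ring_mod R x\<^esub> u = \<zero>\<^bsub>residue_ring_mod R x\<^esub>}"

text \<open>The Cohen--Macaulay type of a one-dimensional Cohen--Macaulay local ring \<open>R\<close> with coefficient
  field \<open>k\<close>: the \<open>k\<close>-dimension of the socle of \<open>R/xR\<close>, for \<open>x\<close> a nonzerodivisor in the maximal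
  ideal (the value does not depend on \<open>x\<close>).\<close>

definition cm_type_wrt :: "'k::field fls set \<Rightarrow> 'k fls \<Rightarrow> nat" where
  "cm_type_wrt R x = dim_mod R x (socle_mod R x)"

definition reduced_type_wrt :: "'k::field fls set \<Rightarrow> 'k fls \<Rightarrow> nat" where
  "reduced_type_wrt R x =
     dim_mod R x (residue_class R x ` (conductor R <+>\<^bsub>ring_on R\<^esub> PIdl\<^bsub>ring_on R\<^esub> x))"

text \<open>The element \<open>t\<close> to the power \<open>m(S)\<close>; \<open>fls_X_intpow i\<close> is the \<open>i\<close>-th power of \<open>t\<close> in
  \<open>k((t))\<close>.\<close>

definition min_parameter :: "nat set \<Rightarrow> 'k::field fls" where
  "min_parameter S = fls_X_intpow (int (multiplicity_sg S))"

text \<open>The argument \<open>TYPE('k)\<close> names the field \<open>k\<close>.\<close>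

definition cm_type :: "'k::field itself \<Rightarrow> nat set \<Rightarrow> nat" where
  "cm_type _ S = cm_type_wrt (semigroup_ring S :: 'k fls set) (min_parameter S)"

definition reduced_type :: "'k::field itself \<Rightarrow> nat set \<Rightarrow> nat" where
  "reduced_type _ S = reduced_type_wrt (semigroup_ring S :: 'k fls set) (min_parameter S)"

definition maximal_reduced_type :: "'k::field itself \<Rightarrow> nat set \<Rightarrow> bool" where
  "maximal_reduced_type k S \<longleftrightarrow> reduced_type k S = cm_type k S"

definition minimal_reduced_type :: "'k::field itself \<Rightarrow> nat set \<Rightarrow> bool" where
  "minimal_reduced_type k S \<longleftrightarrow> reduced_type k S = 1"

end

theory Submission
  imports Defs
begin

text \<open>
  Both ring-theoretic numbers are computed from the semigroup. Write \<open>m\<close> for the multiplicity and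
  \<open>R = k[[S]]\<close>. Modulo \<open>t\<^sup>m R\<close> only the coefficients at the Apery exponents survive, that is, at
  the \<open>w \<in> S\<close> with \<open>w - m \<notin> S\<close>; so the classes of series whose surviving coefficients sit in a
  set \<open>W\<close> of Apery exponents form a space of dimension \<open>card W\<close>. The conductor consists of the
  series of order greater than the Frobenius number \<open>F\<close>, and it gives the Apery exponents above
  \<open>F\<close>. The socle gives the Apery exponents \<open>f + m\<close> with \<open>f\<close> pseudo-Frobenius. Hence the reduced
  type is the number of gaps in \<open>[F - m + 1, F]\<close>, and the type is the number of pseudo-Frobenius
  numbers. All gaps in that window are pseudo-Frobenius, so it suffices to find a second gap in the
  window and a pseudo-Frobenius number below it.

  For the given semigroups put \<open>N = 3n + 2\<close> and \<open>B = rN\<close>; the generators are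
  \<open>B + 3\<close>, \<open>B + 6\<close>, \<open>B + N + 2\<close>, \<open>B + N + 3\<close>. A sum of \<open>j\<close> generators is \<open>j(B + 3)\<close> plus an
  excess that is a sum of at most \<open>j\<close> copies of \<open>3\<close>, \<open>N - 1\<close>, \<open>N\<close>. The numbers
  \<open>N - 3\<close> and \<open>N - 4\<close> are not of the form \<open>3b + (N - 1)c + Nd\<close>, while all larger numbers are, and
  \<open>r + 1\<close> summands suffice for all excesses up to the beginning of the next layer. Therefore
  \<open>F = (r + 1)(B + 3) + N - 3\<close>, and \<open>F - 1\<close> is also a gap. The pseudo-Frobenius number below the
  window is \<open>f = (n + 1)B + 4N - 3\<close>: it would need \<open>n + 1\<close> generators, which are too few, but each
  \<open>f\<close> plus a generator is a sum of \<open>n + 2\<close> generators.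
\<close>

section \<open>Residue classes modulo a principal ideal\<close>

lemma ring_on_simps [simp]:
  "carrier (ring_on R) = R"
  "x \<otimes>\<^bsub>ring_on R\<^esub> y = x * y"
  "x \<oplus>\<^bsub>ring_on R\<^esub> y = x + y"
  "\<one>\<^bsub>ring_on R\<^esub> = 1"
  "\<zero>\<^bsub>ring_on R\<^esub> = 0"
  by (simp_all add: ring_on_def ring_of_type_algebra_def)

lemma cring_ring_on:
  fixes R :: "'a::field set"
  assumes "1 \<in> R" and diff: "\<And>a b. a \<in> R \<Longrightarrow> b \<in> R \<Longrightarrow> a - b \<in> R"
    and mult: "\<And>a b. a \<in> R \<Longrightarrow> b \<in> R \<Longrightarrow> a * b \<in> R"
  shows "cring (ring_on R)"
proof -
  have zero: "0 \<in> R" using diff[OF assms(1) assms(1)] by simp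
  have uminus: "- a \<in> R" if "a \<in> R" for a using diff[OF zero that] by simp
  have add: "a + b \<in> R" if "a \<in> R" "b \<in> R" for a b
    using diff[OF that(1) uminus[OF that(2)]] by simp
  show ?thesis
  proof (rule cringI)
    show "abelian_group (ring_on R)"
    proof (rule abelian_groupI)
      fix a assume "a \<in> carrier (ring_on R)"
      then show "\<exists>b\<in>carrier (ring_on R). b \<oplus>\<^bsub>ring_on R\<^esub> a = \<zero>\<^bsub>ring_on R\<^esub>"
        using uminus by (intro bexI[of _ "- a"]) auto
    qed (auto simp: zero add)
    show "Group.comm_monoid (ring_on R)"
      by (rule comm_monoidI) (auto simp: assms mult)
  qed (auto simp: distrib_right)
qed

locale principal_quotient =
  fixes R :: "'a::field set" and x :: 'a
  assumes cring_R: "cring (ring_on R)" and x_in: "x \<in> R"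
begin

sublocale R: cring "ring_on R" by (rule cring_R)

lemma PIdl_eq: "PIdl\<^bsub>ring_on R\<^esub> x = {a * x | a. a \<in> R}"
  by (simp add: cgenideal_def)

sublocale I: ideal "PIdl\<^bsub>ring_on R\<^esub> x" "ring_on R"
  using R.cgenideal_ideal x_in by simp

sublocale Q: ring "residue_ring_mod R x"
  unfolding residue_ring_mod_def by (rule I.quotient_is_ring)

sublocale class_hom: ring_hom_ring "ring_on R" "residue_ring_mod R x" "residue_class R x"
proof -
  have "residue_class R x = (+>\<^bsub>ring_on R\<^esub>) (PIdl\<^bsub>ring_on R\<^esub> x)"
    by (rule ext) (simp add: residue_class_def)
  then show "ring_hom_ring (ring_on R) (residue_ring_mod R x) (residue_class R x)"
    using I.rcos_ring_hom_ring by (simp add: residue_ring_mod_def)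
qed

lemma residue_class_eq: "residue_class R x f = (\<lambda>a. a * x + f) ` R"
  by (auto simp: residue_class_def a_r_coset_def' PIdl_eq)

lemma residue_class_eq_iff:
  assumes "f \<in> R" "g \<in> R"
  shows "residue_class R x f = residue_class R x g \<longleftrightarrow> f - g \<in> (\<lambda>a. a * x) ` R"
proof
  assume "residue_class R x f = residue_class R x g"
  moreover have "f \<in> residue_class R x f"
    using R.zero_closed unfolding residue_class_eq by force
  ultimately obtain a where "a \<in> R" "f = a * x + g" unfolding residue_class_eq by blast
  then show "f - g \<in> (\<lambda>a. a * x) ` R" by auto
next
  assume "f - g \<in> (\<lambda>a. a * x) ` R"
  then obtain a where a: "a \<in> R" "f = a * x + g" by (auto simp: algebra_simps)
  have neg: "b - a \<in> R" if "b \<in> R" for b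
  proof -
    obtain c where "c \<in> R" "c + a = 0" using R.add.l_inv_ex[of a] a(1) by auto
    then show ?thesis using R.a_closed[of b c] that by (simp add: eq_neg_iff_add_eq_0 [symmetric])
  qed
  have "b * x + f \<in> residue_class R x g" if "b \<in> R" for b
    unfolding residue_class_eq using R.a_closed[of b a] that a
    by (intro image_eqI[of _ _ "b + a"]) (auto simp: algebra_simps)
  moreover have "b * x + g \<in> residue_class R x f" if "b \<in> R" for b
    unfolding residue_class_eq using neg that a
    by (intro image_eqI[of _ _ "b - a"]) (auto simp: algebra_simps)
  ultimately show "residue_class R x f = residue_class R x g"
    unfolding residue_class_eq by blast
qed

lemma zero_residue_ring: "\<zero>\<^bsub>residue_ring_mod R x\<^esub> = residue_class R x 0"
  using class_hom.hom_zero by simp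

lemma carrier_residue_ring: "carrier (residue_ring_mod R x) = residue_class R x ` R"
  by (auto simp: residue_ring_mod_def FactRing_def A_RCOSETS_def' residue_class_def)

end

section \<open>Power series supported on a semigroup\<close>

definition series_on :: "nat set \<Rightarrow> 'k::field fps set" where
  "series_on A = {f. \<forall>i. fps_nth f i \<noteq> 0 \<longrightarrow> i \<in> A}"

lemma fps_mult_nth_nonzeroE:
  fixes f g :: "'k::field fps"
  assumes "fps_nth (f * g) n \<noteq> 0"
  obtains i j where "n = i + j" "fps_nth f i \<noteq> 0" "fps_nth g j \<noteq> 0"
proof -
  have "\<exists>i\<in>{0..n}. fps_nth f i * fps_nth g (n - i) \<noteq> 0"
    using assms unfolding fps_mult_nth by (meson sum.neutral)
  then obtain i where "i \<le> n" "fps_nth f i \<noteq> 0" "fps_nth g (n - i) \<noteq> 0" by auto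
  then show thesis using that[of i "n - i"] by simp
qed

lemma series_on_mult:
  assumes "submonoid_nat S" "f \<in> series_on S" "g \<in> series_on S"
  shows "f * g \<in> series_on S"
  using assms unfolding series_on_def submonoid_nat_def
  by (auto elim!: fps_mult_nth_nonzeroE)

lemma X_power_in_series_on: "j \<in> S \<Longrightarrow> fps_X ^ j \<in> series_on S"
  by (auto simp: series_on_def fps_X_power_nth split: if_splits)

text \<open>The recursion for the coefficients of \<open>1/f\<close> writes the \<open>n\<close>-th one through products of
  earlier ones with coefficients of \<open>f\<close>, so no exponent outside \<open>S\<close> can appear.\<close>

lemma series_on_inverse:
  assumes S: "submonoid_nat S" and f: "f \<in> series_on S" "fps_nth f 0 \<noteq> 0"
  shows "inverse f \<in> series_on S"
proof -
  have "n \<in> S" if "fps_nth (inverse f) n \<noteq> 0" for n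
    using that
  proof (induction n rule: less_induct)
    case (less n)
    show ?case
    proof (cases n)
      case 0
      then show ?thesis using S by (simp add: submonoid_nat_def)
    next
      case (Suc k)
      have "fps_nth (inverse f * f) n = 0" using f(2) Suc by (simp add: inverse_mult_eq_1)
      then have *: "(\<Sum>i=0..n. fps_nth (inverse f) i * fps_nth f (n - i)) = 0"
        by (simp add: fps_mult_nth)
      have "\<exists>i<n. fps_nth (inverse f) i * fps_nth f (n - i) \<noteq> 0"
      proof (rule ccontr)
        assume "\<not> ?thesis"
        then have "(\<Sum>i=0..n. fps_nth (inverse f) i * fps_nth f (n - i))
            = (\<Sum>i=0..n. if i = n then fps_nth (inverse f) n * fps_nth f 0 else 0)"
          by (intro sum.cong) auto
        also have "\<dots> = fps_nth (inverse f) n * fps_nth f 0" by simp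
        finally show False using * less.prems f(2) by simp
      qed
      then obtain i where "i < n" "fps_nth (inverse f) i \<noteq> 0" "fps_nth f (n - i) \<noteq> 0" by auto
      then have "i \<in> S" "n - i \<in> S" "n = i + (n - i)"
        using less.IH f(1) by (auto simp: series_on_def)
      then show ?thesis using S unfolding submonoid_nat_def by metis
    qed
  qed
  then show ?thesis by (simp add: series_on_def)
qed

text \<open>If \<open>y\<close> had a pole, then in \<open>p(y) = 0\<close> the leading term would have a pole of strictly larger
  order than all the other terms and could not cancel.\<close>

lemma monic_root_power_series:
  fixes y :: "'k::field fls"
  assumes monic: "lead_coeff p = 1" and coeffs: "\<And>i. Polynomial.coeff p i \<in> range fps_to_fls"
    and root: "poly p y = 0"
  shows "y \<in> range fps_to_fls"
proof -
  have "fls_subdegree y \<ge> 0"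
  proof (rule ccontr)
    assume neg: "\<not> ?thesis"
    define e where "e = int (degree p) * fls_subdegree y"
    have y0: "y \<noteq> 0" using neg by auto
    have low: "fls_nth (Polynomial.coeff p i * y ^ i) e = 0" if "i < degree p" for i
    proof (rule fls_times_nth_eq0)
      have "e < int i * fls_subdegree y"
        unfolding e_def using that neg by (intro mult_strict_right_mono_neg) auto
      moreover have "fls_subdegree (Polynomial.coeff p i) \<ge> 0"
        using coeffs[of i] fls_subdegree_fls_to_fps_gt0 by auto
      ultimately show "e < fls_subdegree (Polynomial.coeff p i) + fls_subdegree (y ^ i)"
        by (simp add: fls_subdegree_pow)
    qed
    have "0 = fls_nth (\<Sum>i\<le>degree p. Polynomial.coeff p i * y ^ i) e"
      using root by (simp add: poly_altdef)
    also have "\<dots> = (\<Sum>i\<le>degree p. fls_nth (Polynomial.coeff p i * y ^ i) e)"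
      by (simp add: fls_nth_sum)
    also have "\<dots> = (\<Sum>i\<in>{degree p}. fls_nth (Polynomial.coeff p i * y ^ i) e)"
      by (rule sum.mono_neutral_right) (auto intro: low)
    also have "\<dots> = fls_nth (y ^ degree p) (fls_subdegree (y ^ degree p))"
      using monic by (simp add: e_def fls_subdegree_pow)
    finally show False using y0 by (metis nth_fls_subdegree_nonzero power_not_zero)
  qed
  then have "fps_to_fls (fls_regpart y) = y"
    by (intro fls_eqI) auto
  then show ?thesis by (metis rangeI)
qed


section \<open>Type and reduced type of a numerical semigroup ring\<close>

text \<open>The hypotheses say that \<open>F\<close> is the Frobenius number. That it is a natural number excludes
  \<open>S = \<nat>\<close>, whose Frobenius and pseudo-Frobenius number is \<open>-1\<close>.\<close>

locale proper_numerical_semigroup =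
  fixes S :: "nat set" and F :: nat
  assumes submonoid: "submonoid_nat S"
    and Frobenius_notin: "F \<notin> S"
    and above_Frobenius: "\<And>i. F < i \<Longrightarrow> i \<in> S"
begin

lemma zero_in: "0 \<in> S" and add_in: "a \<in> S \<Longrightarrow> b \<in> S \<Longrightarrow> a + b \<in> S"
  using submonoid by (auto simp: submonoid_nat_def)

lemma numerical: "numerical_semigroup S"
proof -
  have "- S \<subseteq> {..F}" using above_Frobenius by (force simp: not_less[symmetric])
  then show ?thesis using submonoid finite_subset by (auto simp: numerical_semigroup_def)
qed

abbreviation m :: nat where "m \<equiv> multiplicity_sg S"

lemma m_in: "m \<in> S" and m_pos: "0 < m" and m_le: "s \<in> S \<Longrightarrow> s \<noteq> 0 \<Longrightarrow> m \<le> s"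
proof -
  have "Suc F \<in> S \<and> Suc F \<noteq> 0" using above_Frobenius by simp
  from LeastI[of "\<lambda>s. s \<in> S \<and> s \<noteq> 0", OF this] show "m \<in> S" "0 < m"
    unfolding multiplicity_sg_def by auto
  show "s \<in> S \<Longrightarrow> s \<noteq> 0 \<Longrightarrow> m \<le> s"
    unfolding multiplicity_sg_def by (rule Least_le) simp
qed

lemma F_pos: "0 < F"
  using Frobenius_notin zero_in by (cases F) auto

definition Apery :: "nat set" where
  "Apery = {w \<in> S. \<forall>s\<in>S. w \<noteq> s + m}"

definition pseudo_Frobenius :: "nat set" where
  "pseudo_Frobenius = {f. f \<notin> S \<and> (\<forall>s\<in>S - {0}. f + s \<in> S)}"

lemma Apery_cases:
  assumes "w \<in> Apery"
  obtains "w = 0" | g where "g \<notin> S" "w = g + m"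
proof (cases "w = 0")
  case False
  then have "m \<le> w" "w = (w - m) + m" using assms m_le by (auto simp: Apery_def)
  moreover from this have "w - m \<notin> S" using assms unfolding Apery_def by blast
  ultimately show ?thesis using that(2) by blast
qed (use that in blast)

lemma gap_in_Apery: "g \<notin> S \<Longrightarrow> g + m \<in> S \<Longrightarrow> g + m \<in> Apery"
  by (auto simp: Apery_def)

lemma finite_Apery: "finite Apery"
proof -
  have "w \<le> F + m" if "w \<in> Apery" for w
    using that by (rule Apery_cases) (use above_Frobenius in \<open>force simp: not_less[symmetric]\<close>)+
  then show ?thesis using finite_nat_set_iff_bounded_le by blast
qed

lemma semigroup_ring_eq: "(semigroup_ring S :: 'k::field fls set) = fps_to_fls ` series_on S"
  by (simp add: semigroup_ring_def power_series_subring_minimal_generators[OF numerical]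
      series_on_def)

lemma min_parameter_eq: "(min_parameter S :: 'k::field fls) = fps_to_fls (fps_X ^ m)"
  by (intro fls_eqI) (auto simp: min_parameter_def fps_X_power_nth nat_eq_iff)

lemma const_in_series_on: "fps_const c \<in> series_on S"
  using zero_in by (auto simp: series_on_def fps_const_def)

lemma diff_in_series_on: "f \<in> series_on S \<Longrightarrow> g \<in> series_on S \<Longrightarrow> f - g \<in> series_on S"
  by (force simp: series_on_def)

lemma add_in_series_on: "f \<in> series_on S \<Longrightarrow> g \<in> series_on S \<Longrightarrow> f + g \<in> series_on S"
  by (force simp: series_on_def)

lemma principal_quotient: "principal_quotient (semigroup_ring S :: 'k::field fls set) (min_parameter S)"
proof (rule principal_quotient.intro)
  show "cring (ring_on (semigroup_ring S :: 'k fls set))"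
  proof (rule cring_ring_on)
    show "1 \<in> (semigroup_ring S :: 'k fls set)"
      unfolding semigroup_ring_eq using const_in_series_on[of 1] by force
  qed (auto simp: semigroup_ring_eq series_on_mult[OF submonoid] diff_in_series_on
        simp flip: fls_times_fps_to_fls fps_to_fls_minus)
  show "min_parameter S \<in> (semigroup_ring S :: 'k fls set)"
    using X_power_in_series_on[OF m_in] by (auto simp: semigroup_ring_eq min_parameter_eq)
qed

abbreviation series_class :: "'k::field fps \<Rightarrow> 'k fls set" where
  "series_class f \<equiv> residue_class (semigroup_ring S) (min_parameter S) (fps_to_fls f)"

text \<open>A series on \<open>S\<close> can be divided by \<open>t\<^sup>m\<close> inside \<open>R\<close> exactly when shifting its exponents down
  by \<open>m\<close> does not leave \<open>S\<close>. So the Apery coefficients are coordinates on \<open>R / t\<^sup>m R\<close>.\<close>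

lemma multiple_of_min_parameter_iff:
  assumes "f \<in> series_on S"
  shows "fps_to_fls f \<in> (\<lambda>a. a * min_parameter S) ` (semigroup_ring S :: 'k::field fls set)
    \<longleftrightarrow> (\<forall>w\<in>Apery. fps_nth f w = 0)"
proof
  assume "fps_to_fls f \<in> (\<lambda>a. a * min_parameter S) ` (semigroup_ring S :: 'k fls set)"
  then obtain g where g: "g \<in> series_on S" "fps_to_fls f = fps_to_fls (g * fps_X ^ m)"
    by (auto simp: semigroup_ring_eq min_parameter_eq simp flip: fls_times_fps_to_fls)
  then have f: "f = g * fps_X ^ m" by (simp only: fps_to_fls_eq_iff)
  show "\<forall>w\<in>Apery. fps_nth f w = 0"
  proof (rule ballI, rule ccontr)
    fix w assume w: "w \<in> Apery" "fps_nth f w \<noteq> 0"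
    then have "m \<le> w" "w - m \<in> S"
      using g(1) by (auto simp: f fps_X_power_mult_right_nth series_on_def split: if_splits)
    moreover from this have "w = (w - m) + m" by simp
    ultimately show False using w(1) unfolding Apery_def by blast
  qed
next
  assume zero: "\<forall>w\<in>Apery. fps_nth f w = 0"
  define g where "g = fps_shift m f"
  have supp: "\<exists>s\<in>S. i = s + m" if "fps_nth f i \<noteq> 0" for i
    using that zero assms unfolding Apery_def series_on_def by blast
  have "i \<in> S" if "fps_nth g i \<noteq> 0" for i
    using supp[of "i + m"] that by (auto simp: g_def)
  then have "g \<in> series_on S" by (simp add: series_on_def)
  moreover have "fps_nth f i = 0" if "i < m" for i
    using supp[of i] that by (cases "fps_nth f i = 0") auto
  then have "f = g * fps_X ^ m"
    by (intro fps_ext) (simp add: g_def fps_X_power_mult_right_nth)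
  then have "fps_to_fls f = fps_to_fls g * min_parameter S"
    by (simp only: min_parameter_eq fls_times_fps_to_fls)
  ultimately show "fps_to_fls f \<in> (\<lambda>a. a * min_parameter S) ` (semigroup_ring S :: 'k fls set)"
    by (intro image_eqI[of _ _ "fps_to_fls g"]) (simp_all only: semigroup_ring_eq imageI)
qed

lemma series_class_eq_iff:
  fixes f g :: "'k::field fps"
  assumes "f \<in> series_on S" "g \<in> series_on S"
  shows "series_class f = series_class g \<longleftrightarrow> (\<forall>w\<in>Apery. fps_nth f w = fps_nth g w)"
proof -
  interpret principal_quotient "semigroup_ring S :: 'k fls set" "min_parameter S"
    by (rule principal_quotient)
  have "series_class f = series_class g \<longleftrightarrow>
      fps_to_fls (f - g) \<in> (\<lambda>a. a * min_parameter S) ` (semigroup_ring S :: 'k fls set)"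
    using assms by (subst residue_class_eq_iff) (auto simp: semigroup_ring_eq)
  then show ?thesis
    by (simp only: multiple_of_min_parameter_iff[OF diff_in_series_on[OF assms]] fps_sub_nth right_minus_eq)
qed

definition coordinate_space :: "nat set \<Rightarrow> 'k::field fps set" where
  "coordinate_space W = {f \<in> series_on S. \<forall>w\<in>Apery - W. fps_nth f w = 0}"

lemma subfield_constants:
  "subfield (range (\<lambda>c. residue_class (semigroup_ring S) (min_parameter S) (fls_const (c::'k::field))))
     (residue_ring_mod (semigroup_ring S) (min_parameter S))"
proof -
  interpret principal_quotient "semigroup_ring S :: 'k fls set" "min_parameter S"
    by (rule principal_quotient)
  have sub: "range fls_const \<subseteq> (semigroup_ring S :: 'k fls set)"
    using const_in_series_on by (force simp: semigroup_ring_eq simp flip: fps_const_to_fls)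
  have cr: "cring (ring_on (range fls_const :: 'k fls set))"
  proof (rule cring_ring_on)
    show "1 \<in> (range fls_const :: 'k fls set)" by (metis fls_const_1 rangeI)
  qed (auto simp: fls_minus_const)
  have "field (ring_on (range fls_const :: 'k fls set))"
  proof (rule cring.cring_fieldI2[OF cr])
    fix a assume "a \<in> carrier (ring_on (range fls_const :: 'k fls set))"
      "a \<noteq> \<zero>\<^bsub>ring_on (range fls_const :: 'k fls set)\<^esub>"
    then obtain c where "a = fls_const c" "c \<noteq> 0" by auto
    then show "\<exists>b\<in>carrier (ring_on (range fls_const)).
        a \<otimes>\<^bsub>ring_on (range fls_const)\<^esub> b = \<one>\<^bsub>ring_on (range fls_const :: 'k fls set)\<^esub>"
      by (intro bexI[of _ "fls_const (inverse c)"]) auto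
  qed simp
  then have "subfield (range fls_const) (ring_on (semigroup_ring S :: 'k fls set))"
    using sub by (intro R.subfield_iff(1)) (auto simp: ring_on_def)
  moreover have "0 \<in> Apery" using zero_in m_pos by (auto simp: Apery_def)
  then have "series_class (1::'k fps) \<noteq> series_class 0"
    using const_in_series_on[of "1::'k"] const_in_series_on[of "0::'k"]
    by (subst series_class_eq_iff) (auto intro!: bexI[of _ 0])
  then have "\<one>\<^bsub>residue_ring_mod (semigroup_ring S :: 'k fls set) (min_parameter S)\<^esub> \<noteq>
     \<zero>\<^bsub>residue_ring_mod (semigroup_ring S :: 'k fls set) (min_parameter S)\<^esub>"
    using class_hom.hom_one class_hom.hom_zero by simp
  ultimately show ?thesis
    using class_hom.img_is_subfield(2)[of "range fls_const"] by (simp add: image_image)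
qed

text \<open>The classes of the monomials \<open>t\<^sup>w\<close>, \<open>w \<in> W\<close>, form a basis; adjoining one exponent to \<open>W\<close> is
  one line extension.\<close>

lemma dim_coordinate_space:
  assumes "W \<subseteq> Apery"
  shows "dim_mod (semigroup_ring S :: 'k::field fls set) (min_parameter S)
      (series_class ` coordinate_space W) = card W"
proof -
  interpret principal_quotient "semigroup_ring S :: 'k fls set" "min_parameter S"
    by (rule principal_quotient)
  let ?Q = "residue_ring_mod (semigroup_ring S :: 'k fls set) (min_parameter S)"
  let ?k = "range (\<lambda>c. residue_class (semigroup_ring S) (min_parameter S) (fls_const (c::'k)))"
  have in_R: "fps_to_fls f \<in> semigroup_ring S" if "f \<in> series_on S" for f :: "'k fps"
    using that by (simp add: semigroup_ring_eq)
  have "finite W" using assms finite_Apery finite_subset by blast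
  then have "Q.dimension (card W) ?k (series_class ` coordinate_space W)"
    using assms
  proof (induction W rule: finite_induct)
    case empty
    have zero: "0 \<in> series_on S" by (simp add: series_on_def)
    have "series_class f = series_class (0::'k fps)" if "f \<in> coordinate_space {}" for f
      using that zero by (subst series_class_eq_iff) (auto simp: coordinate_space_def)
    moreover have "0 \<in> coordinate_space {}" using zero by (simp add: coordinate_space_def)
    ultimately have "series_class ` coordinate_space {} = {series_class (0::'k fps)}" by blast
    then show ?case using Q.zero_dim[of ?k] zero_residue_ring by simp
  next
    case (insert w W)
    let ?t = "fps_X ^ w :: 'k fps"
    have w: "w \<in> S" "w \<in> Apery" using insert.prems by (auto simp: Apery_def)
    have t: "?t \<in> series_on S" using w X_power_in_series_on by blast
    have notin: "series_class ?t \<notin> series_class ` coordinate_space W"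
    proof
      assume "series_class ?t \<in> series_class ` coordinate_space W"
      then obtain g :: "'k fps" where "g \<in> coordinate_space W" "series_class ?t = series_class g" by blast
      then have "fps_nth g w = 0" "fps_nth g w = fps_nth ?t w"
        using t w insert.hyps by (auto simp: coordinate_space_def series_class_eq_iff)
      then show False by simp
    qed
    have smult: "series_class (fps_const c * ?t + g) =
        residue_class (semigroup_ring S) (min_parameter S) (fls_const c) \<otimes>\<^bsub>?Q\<^esub> series_class ?t
          \<oplus>\<^bsub>?Q\<^esub> series_class g" if "g \<in> series_on S" for c and g :: "'k fps"
    proof -
      have "fls_const c \<in> semigroup_ring S"
        using in_R[OF const_in_series_on[of c]] by simp
      then show ?thesis
        using class_hom.hom_add[of "fls_const c * fps_to_fls ?t" "fps_to_fls g"]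
          class_hom.hom_mult[of "fls_const c" "fps_to_fls ?t"]
          R.m_closed[of "fls_const c" "fps_to_fls ?t"] in_R[OF t] in_R[OF that]
        by (simp add: fls_times_fps_to_fls)
    qed
    have in_insert: "fps_const c * ?t + g \<in> coordinate_space (insert w W)"
      if "g \<in> coordinate_space W" for c and g :: "'k fps"
      using that add_in_series_on series_on_mult[OF submonoid const_in_series_on t]
      by (auto simp: coordinate_space_def fps_X_power_nth)
    have "Q.line_extension ?k (series_class ?t) (series_class ` coordinate_space W)
        = series_class ` coordinate_space (insert w W)"
    proof (intro equalityI subsetI)
      fix u assume "u \<in> Q.line_extension ?k (series_class ?t) (series_class ` coordinate_space W)"
      then obtain c and g :: "'k fps" where "g \<in> coordinate_space W"
        "u = series_class (fps_const c * ?t + g)"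
        unfolding Q.line_extension_mem_iff using smult by (auto simp: coordinate_space_def)
      then show "u \<in> series_class ` coordinate_space (insert w W)" using in_insert by blast
    next
      fix u assume "u \<in> series_class ` (coordinate_space (insert w W) :: 'k fps set)"
      then obtain f :: "'k fps" where f: "f \<in> coordinate_space (insert w W)" "u = series_class f"
        by blast
      define g where "g = f - fps_const (fps_nth f w) * ?t"
      have "g \<in> coordinate_space W"
        using f diff_in_series_on series_on_mult[OF submonoid const_in_series_on t]
        by (auto simp: coordinate_space_def fps_X_power_nth g_def)
      moreover have "f = fps_const (fps_nth f w) * ?t + g" by (simp add: g_def)
      ultimately show "u \<in> Q.line_extension ?k (series_class ?t) (series_class ` coordinate_space W)"
        unfolding Q.line_extension_mem_iff f(2)
        using smult by (metis (no_types, lifting) coordinate_space_def imageI mem_Collect_eq rangeI)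
    qed
    moreover have "series_class ?t \<in> carrier ?Q"
      unfolding carrier_residue_ring using in_R[OF t] by (rule imageI)
    then have "Q.dimension (Suc (card W)) ?k
        (Q.line_extension ?k (series_class ?t) (series_class ` coordinate_space W))"
      using insert.IH insert.prems by (intro Q.Suc_dim notin) auto
    ultimately show ?case by (simp only: card_insert_disjoint[OF insert.hyps])
  qed
  then show ?thesis
    unfolding dim_mod_def using Q.dimI[OF subfield_constants] by (simp add: over_def)
qed


lemma integral_closure_subset:
  "integral_closure (semigroup_ring S :: 'k::field fls set) \<subseteq> range fps_to_fls"
  using monic_root_power_series unfolding integral_closure_def semigroup_ring_eq by blast

lemma subset_quotient_field:
  "semigroup_ring S \<subseteq> quotient_field (semigroup_ring S :: 'k::field fls set)"
proof
  fix z assume "z \<in> (semigroup_ring S :: 'k fls set)"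
  moreover have "fps_to_fls (fps_const 1) \<in> (semigroup_ring S :: 'k fls set)"
    unfolding semigroup_ring_eq using const_in_series_on by blast
  then have "1 \<in> (semigroup_ring S :: 'k fls set)" by simp
  moreover have "z = z / 1" by simp
  ultimately show "z \<in> quotient_field (semigroup_ring S)"
    unfolding quotient_field_def using one_neq_zero by blast
qed

text \<open>\<open>t\<^sup>j\<close> is a quotient of two monomials above the Frobenius number and a root of
  \<open>X\<^sup>m - t\<^sup>j\<^sup>m\<close>.\<close>

lemma X_power_in_integral_closure:
  "fps_to_fls (fps_X ^ j) \<in> integral_closure (semigroup_ring S :: 'k::field fls set)"
proof -
  let ?R = "semigroup_ring S :: 'k fls set"
  have pow: "fps_to_fls (fps_X ^ i) \<in> ?R" if "i \<in> S" for i
    unfolding semigroup_ring_eq using X_power_in_series_on[OF that] by (rule imageI)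
  have const: "fls_const c \<in> ?R" for c
    using const_in_series_on[of c] unfolding semigroup_ring_eq by (metis fps_const_to_fls imageI)
  define d where "d = (fps_to_fls (fps_X ^ j) :: 'k fls)"
  have "d * fps_to_fls (fps_X ^ Suc F) = fps_to_fls (fps_X ^ (j + Suc F))"
    by (simp only: d_def fls_times_fps_to_fls power_add)
  moreover have nz: "(fps_to_fls (fps_X ^ Suc F) :: 'k fls) \<noteq> 0" by simp
  ultimately have "d = fps_to_fls (fps_X ^ (j + Suc F)) / fps_to_fls (fps_X ^ Suc F)"
    by (metis nonzero_mult_div_cancel_right)
  then have "d \<in> quotient_field ?R"
    unfolding quotient_field_def using nz pow[of "j + Suc F"] pow[of "Suc F"] above_Frobenius
    by fastforce
  moreover define p where "p = Polynomial.monom 1 m - [:d ^ m:]"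
  have deg: "degree p = m"
    unfolding p_def diff_conv_add_uminus using m_pos
    by (subst degree_add_eq_left) (auto simp: degree_monom_eq)
  then have "lead_coeff p = 1" using m_pos by (simp add: p_def coeff_pCons split: nat.split)
  moreover have "d ^ m = fps_to_fls (fps_X ^ (j * m))"
    by (simp add: d_def fps_to_fls_power power_mult)
  then have "- (d ^ m) = fps_to_fls (0 - fps_X ^ (j * m))" by simp
  then have "- (d ^ m) \<in> ?R"
    unfolding semigroup_ring_eq
    using diff_in_series_on[OF const_in_series_on[of 0]
        X_power_in_series_on[OF submonoid_nat_mult[OF submonoid m_in, of j]]]
    by (simp only: fps_const_0_eq_0) (erule imageI)
  then have "Polynomial.coeff p i \<in> ?R" for i
    using const[of 0] const[of 1] m_pos
    by (auto simp: p_def coeff_pCons split: nat.split)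
  moreover have "poly p d = 0" by (simp add: p_def poly_monom)
  ultimately show ?thesis unfolding integral_closure_def d_def by blast
qed

text \<open>If a series in the conductor had a nonzero coefficient at some \<open>i \<le> F\<close>, then multiplying it
  by the integral element \<open>t\<^sup>F\<^sup>-\<^sup>i\<close> would move that coefficient to the gap \<open>F\<close>.\<close>

lemma conductor_eq:
  "conductor (semigroup_ring S :: 'k::field fls set) = fps_to_fls ` series_on {F<..}"
proof (intro equalityI subsetI)
  let ?R = "semigroup_ring S :: 'k fls set"
  fix z assume "z \<in> conductor ?R"
  then have z: "z * fps_to_fls (fps_X ^ j) \<in> ?R" for j
    using X_power_in_integral_closure by (auto simp: conductor_def)
  from z[of 0] obtain f where f: "z = fps_to_fls f" by (auto simp: semigroup_ring_eq)
  have "F < i" if "fps_nth f i \<noteq> 0" for i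
  proof (rule ccontr)
    assume "\<not> F < i"
    moreover from this have "fps_nth (f * fps_X ^ (F - i)) F \<noteq> 0"
      using that by (simp add: fps_X_power_mult_right_nth)
    moreover have "f * fps_X ^ (F - i) \<in> series_on S"
      using z[of "F - i"] by (auto simp: f semigroup_ring_eq simp flip: fls_times_fps_to_fls)
    ultimately show False using Frobenius_notin by (auto simp: series_on_def)
  qed
  then show "z \<in> fps_to_fls ` series_on {F<..}" by (auto simp: f series_on_def)
next
  let ?R = "semigroup_ring S :: 'k fls set"
  fix z :: "'k fls" assume "z \<in> fps_to_fls ` series_on {F<..}"
  then obtain f where f: "f \<in> series_on {F<..}" "z = fps_to_fls f" by blast
  have mult: "f * g \<in> series_on S" for g
    unfolding series_on_def
    using f(1) above_Frobenius by (fastforce simp: series_on_def elim!: fps_mult_nth_nonzeroE)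
  have "z \<in> ?R" using mult[of 1] by (simp add: f semigroup_ring_eq)
  moreover have "z * y \<in> ?R" if "y \<in> integral_closure ?R" for y
    using integral_closure_subset that mult
    by (auto simp: f semigroup_ring_eq simp flip: fls_times_fps_to_fls)
  ultimately show "z \<in> conductor ?R"
    using subset_quotient_field by (auto simp: conductor_def)
qed

text \<open>Modulo \<open>t\<^sup>m R\<close> the conductor is the coordinate space of the Apery exponents above \<open>F\<close>, and
  these are the gaps in \<open>[F - m + 1, F]\<close> shifted by \<open>m\<close>.\<close>

theorem reduced_type_eq:
  "reduced_type TYPE('k::field) S = card {g. g \<notin> S \<and> F < g + m}"
proof -
  let ?R = "semigroup_ring S :: 'k fls set" and ?x = "min_parameter S :: 'k fls"
  interpret principal_quotient ?R ?x by (rule principal_quotient)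
  define W where "W = {w \<in> Apery. F < w}"
  have "residue_class ?R ?x ` (conductor ?R <+>\<^bsub>ring_on ?R\<^esub> PIdl\<^bsub>ring_on ?R\<^esub> ?x)
      = series_class ` coordinate_space W"
  proof (intro equalityI subsetI)
    fix u assume "u \<in> residue_class ?R ?x ` (conductor ?R <+>\<^bsub>ring_on ?R\<^esub> PIdl\<^bsub>ring_on ?R\<^esub> ?x)"
    then obtain y z where "y \<in> conductor ?R" "z \<in> PIdl\<^bsub>ring_on ?R\<^esub> ?x"
      "u = residue_class ?R ?x (y + z)"
      by (auto simp: set_add_def')
    then obtain f g where fg: "f \<in> series_on {F<..}" "g \<in> series_on S"
      "u = residue_class ?R ?x (fps_to_fls f + fps_to_fls g * ?x)"
      unfolding conductor_eq PIdl_eq unfolding semigroup_ring_eq by blast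
    have fS: "f \<in> series_on S" using fg(1) above_Frobenius by (auto simp: series_on_def)
    then have "f \<in> coordinate_space W" using fg(1)
      by (auto simp: coordinate_space_def W_def series_on_def)
    moreover have "u = series_class f"
      unfolding fg(3) using fg(2) fS I.a_Hcarr x_in R.a_closed R.m_closed
      by (subst residue_class_eq_iff) (auto simp: semigroup_ring_eq)
    ultimately show "u \<in> series_class ` coordinate_space W" by blast
  next
    fix u assume "u \<in> series_class ` (coordinate_space W :: 'k fps set)"
    then obtain f :: "'k fps" where f: "f \<in> coordinate_space W" "u = series_class f" by blast
    define g where "g = Abs_fps (\<lambda>i. if F < i then fps_nth f i else 0)"
    have g: "g \<in> series_on {F<..}" by (simp add: g_def series_on_def)
    then have "g \<in> series_on S" using above_Frobenius by (auto simp: series_on_def)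
    then have "u = series_class g"
      using f by (auto simp: series_class_eq_iff coordinate_space_def W_def g_def)
    moreover have "0 \<in> PIdl\<^bsub>ring_on ?R\<^esub> ?x"
      using R.zero_closed by (auto simp: PIdl_eq)
    then have "fps_to_fls g \<in> conductor ?R <+>\<^bsub>ring_on ?R\<^esub> PIdl\<^bsub>ring_on ?R\<^esub> ?x"
      using g by (force simp: set_add_def' conductor_eq)
    ultimately show "u \<in> residue_class ?R ?x ` (conductor ?R <+>\<^bsub>ring_on ?R\<^esub> PIdl\<^bsub>ring_on ?R\<^esub> ?x)"
      by blast
  qed
  moreover have W_sub: "W \<subseteq> Apery" by (auto simp: W_def)
  ultimately have "reduced_type TYPE('k) S = card W"
    unfolding reduced_type_def reduced_type_wrt_def
    by (simp only: dim_coordinate_space[OF W_sub])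
  also have "W = (\<lambda>g. g + m) ` {g. g \<notin> S \<and> F < g + m}"
  proof (intro equalityI subsetI)
    fix w assume "w \<in> W"
    then have "w \<in> Apery" "F < w" by (auto simp: W_def)
    then show "w \<in> (\<lambda>g. g + m) ` {g. g \<notin> S \<and> F < g + m}"
      by (cases rule: Apery_cases) auto
  next
    fix w assume "w \<in> (\<lambda>g. g + m) ` {g. g \<notin> S \<and> F < g + m}"
    then show "w \<in> W" using gap_in_Apery above_Frobenius by (auto simp: W_def)
  qed
  also have "card \<dots> = card {g. g \<notin> S \<and> F < g + m}"
    by (simp add: card_image inj_on_def)
  finally show ?thesis .
qed

lemma nonunits_eq:
  "nonunits (semigroup_ring S :: 'k::field fls set) =
     fps_to_fls ` {f \<in> series_on S. fps_nth f 0 = 0}"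
proof -
  let ?R = "semigroup_ring S :: 'k fls set"
  have "fps_to_fls f \<in> Units (ring_on ?R) \<longleftrightarrow> fps_nth f 0 \<noteq> 0"
    if f: "f \<in> series_on S" for f
  proof
    assume "fps_to_fls f \<in> Units (ring_on ?R)"
    then obtain g where "fps_to_fls (f * g) = fps_to_fls 1"
      by (auto simp: Units_def semigroup_ring_eq fls_times_fps_to_fls mult.commute)
    then have "f * g = 1" by (simp only: fps_to_fls_eq_iff)
    then have "fps_nth f 0 * fps_nth g 0 = 1" by (metis fps_mult_nth_0 fps_one_nth)
    then show "fps_nth f 0 \<noteq> 0" by auto
  next
    assume f0: "fps_nth f 0 \<noteq> 0"
    then have "fps_to_fls (inverse f) * fps_to_fls f = fps_to_fls 1"
      "fps_to_fls f * fps_to_fls (inverse f) = fps_to_fls 1"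
      by (simp_all only: flip: fls_times_fps_to_fls)
        (simp_all add: inverse_mult_eq_1 inverse_mult_eq_1')
    then show "fps_to_fls f \<in> Units (ring_on ?R)"
      using f series_on_inverse[OF submonoid f f0] by (auto simp: Units_def semigroup_ring_eq)
  qed
  then show ?thesis by (auto simp: nonunits_def semigroup_ring_eq)
qed

text \<open>A monomial \<open>t\<^sup>s\<close> moves the coefficient of \<open>f\<close> at an Apery exponent \<open>w\<close> to \<open>w + s\<close>, which must
  then not be an Apery exponent if \<open>f\<close> lies in the socle. That this holds for all nonzero
  \<open>s \<in> S\<close> says that \<open>w - m\<close> is pseudo-Frobenius.\<close>

theorem cm_type_eq: "cm_type TYPE('k::field) S = card pseudo_Frobenius"
proof -
  let ?R = "semigroup_ring S :: 'k fls set" and ?x = "min_parameter S :: 'k fls"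
  interpret principal_quotient ?R ?x by (rule principal_quotient)
  define W where "W = (\<lambda>f. f + m) ` pseudo_Frobenius"
  have W_sub: "W \<subseteq> Apery"
    using m_in m_pos gap_in_Apery by (auto simp: W_def pseudo_Frobenius_def)
  have zero: "0 \<in> series_on S" by (simp add: series_on_def)
  have annihilates: "residue_class ?R ?x (fps_to_fls a) \<otimes>\<^bsub>residue_ring_mod ?R ?x\<^esub> series_class f
      = \<zero>\<^bsub>residue_ring_mod ?R ?x\<^esub> \<longleftrightarrow> (\<forall>v\<in>Apery. fps_nth (a * f) v = 0)"
    if "a \<in> series_on S" "f \<in> series_on S" for a f :: "'k fps"
  proof -
    have "residue_class ?R ?x (fps_to_fls a) \<otimes>\<^bsub>residue_ring_mod ?R ?x\<^esub> series_class f
        = series_class (a * f)"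
      using class_hom.hom_mult[of "fps_to_fls a" "fps_to_fls f"] that
      by (simp add: semigroup_ring_eq fls_times_fps_to_fls)
    then show ?thesis
      using series_class_eq_iff[OF series_on_mult[OF submonoid that] zero] zero_residue_ring by simp
  qed
  have "socle_mod ?R ?x = series_class ` coordinate_space W"
  proof (intro equalityI subsetI)
    fix u assume u: "u \<in> socle_mod ?R ?x"
    then have "u \<in> residue_class ?R ?x ` ?R"
      by (simp add: socle_mod_def carrier_residue_ring)
    then obtain y where "y \<in> ?R" "u = residue_class ?R ?x y" by blast
    then obtain f where f: "f \<in> series_on S" "u = series_class f"
      unfolding semigroup_ring_eq by blast
    have "w \<in> W" if w: "w \<in> Apery" "fps_nth f w \<noteq> 0" for w
    proof -
      have shifted: "s + w \<notin> Apery" if s: "s \<in> S" "s \<noteq> 0" for s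
      proof
        assume "s + w \<in> Apery"
        moreover have t: "fps_X ^ s \<in> series_on S" "fps_nth (fps_X ^ s :: 'k fps) 0 = 0"
          using X_power_in_series_on s by (auto simp: fps_X_power_nth)
        then have "fps_to_fls (fps_X ^ s) \<in> nonunits ?R" by (auto simp: nonunits_eq)
        then have "\<forall>v\<in>Apery. fps_nth (fps_X ^ s * f) v = 0"
          using u annihilates[OF t(1) f(1)] f(2) by (auto simp: socle_mod_def)
        ultimately show False using w(2) by (force simp: fps_X_power_mult_nth)
      qed
      from w(1) show "w \<in> W"
      proof (cases rule: Apery_cases)
        case 1
        \<comment> \<open>The class of \<open>1\<close> is not in the socle: \<open>t\<^sup>F\<^sup>+\<^sup>m\<close> does not annihilate it.\<close>
        have "F + m \<in> Apery" using gap_in_Apery Frobenius_notin above_Frobenius m_pos by simp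
        then show ?thesis using shifted[of "F + m"] 1 F_pos by (simp add: Apery_def)
      next
        case (2 g)
        have "g + s \<in> S" if "s \<in> S" "s \<noteq> 0" for s
        proof (rule ccontr)
          assume "g + s \<notin> S"
          moreover have "w \<in> S" using w(1) by (simp add: Apery_def)
          then have "(g + s) + m \<in> S" using add_in[OF _ that(1)] 2(2) by (metis add.commute add.left_commute)
          ultimately have "(g + s) + m \<in> Apery" by (rule gap_in_Apery)
          then show False using shifted[OF that] 2(2) by (simp add: algebra_simps)
        qed
        then show ?thesis using 2 by (auto simp: W_def pseudo_Frobenius_def)
      qed
    qed
    then have "f \<in> coordinate_space W" using f(1) by (auto simp: coordinate_space_def)
    then show "u \<in> series_class ` coordinate_space W" using f(2) by blast
  next
    fix u assume "u \<in> series_class ` (coordinate_space W :: 'k fps set)"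
    then obtain f :: "'k fps" where f: "f \<in> coordinate_space W" "u = series_class f" by blast
    have fS: "f \<in> series_on S" using f(1) by (simp add: coordinate_space_def)
    have "fps_nth (a * f) v = 0"
      if a: "a \<in> series_on S" "fps_nth a 0 = 0" and v: "v \<in> Apery" for a v
    proof (rule ccontr)
      assume "fps_nth (a * f) v \<noteq> 0"
      then obtain i w where iw: "v = i + w" "fps_nth a i \<noteq> 0" "fps_nth f w \<noteq> 0"
        by (rule fps_mult_nth_nonzeroE)
      have i: "i \<in> S" "i \<noteq> 0" using iw(2) a by (auto simp: series_on_def intro: ccontr)
      have "w \<in> Apery"
      proof -
        have "w \<noteq> s + m" if "s \<in> S" for s
          using v add_in[OF i(1) that] iw(1) unfolding Apery_def by (auto simp: add.assoc)
        then show ?thesis using fS iw(3) by (auto simp: Apery_def series_on_def)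
      qed
      then have "w \<in> W" using f(1) iw(3) by (auto simp: coordinate_space_def)
      then obtain g where "w = g + m" "g + i \<in> S"
        using i by (auto simp: W_def pseudo_Frobenius_def)
      then show False using v iw(1) by (auto simp: Apery_def algebra_simps)
    qed
    then show "u \<in> socle_mod ?R ?x"
      unfolding socle_mod_def nonunits_eq carrier_residue_ring f(2)
      using annihilates[OF _ fS] fS by (auto simp: semigroup_ring_eq)
  qed
  then have "cm_type TYPE('k) S = card W"
    unfolding cm_type_def cm_type_wrt_def by (simp only: dim_coordinate_space[OF W_sub])
  also have "\<dots> = card pseudo_Frobenius" by (simp add: W_def card_image inj_on_def)
  finally show ?thesis .
qed


lemma window_subset_pseudo_Frobenius: "{g. g \<notin> S \<and> F < g + m} \<subseteq> pseudo_Frobenius"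
  using above_Frobenius m_le by (fastforce simp: pseudo_Frobenius_def)

lemma finite_pseudo_Frobenius: "finite pseudo_Frobenius"
proof -
  have "pseudo_Frobenius \<subseteq> {..F}"
    using above_Frobenius by (force simp: pseudo_Frobenius_def not_less[symmetric])
  then show ?thesis using finite_subset by blast
qed

lemma not_maximal_reduced_type:
  assumes "f \<in> pseudo_Frobenius" "f + m \<le> F"
  shows "\<not> maximal_reduced_type TYPE('k::field) S"
proof -
  have "f \<notin> {g. g \<notin> S \<and> F < g + m}" using assms(2) by simp
  then have "{g. g \<notin> S \<and> F < g + m} \<subset> pseudo_Frobenius"
    using window_subset_pseudo_Frobenius assms(1) by blast
  then have "card {g. g \<notin> S \<and> F < g + m} < card pseudo_Frobenius"
    by (rule psubset_card_mono[OF finite_pseudo_Frobenius])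
  then show ?thesis by (simp add: maximal_reduced_type_def reduced_type_eq cm_type_eq)
qed

lemma not_minimal_reduced_type:
  assumes "g \<notin> S" "g \<noteq> F" "F < g + m"
  shows "\<not> minimal_reduced_type TYPE('k::field) S"
proof -
  have "{g, F} \<subseteq> {g. g \<notin> S \<and> F < g + m}"
    using assms Frobenius_notin m_pos by auto
  then have "card {g, F} \<le> card {g. g \<notin> S \<and> F < g + m}"
    using finite_subset[OF window_subset_pseudo_Frobenius finite_pseudo_Frobenius]
    by (intro card_mono)
  then show ?thesis using assms(2) by (simp add: minimal_reduced_type_def reduced_type_eq)
qed

end
section \<open>The semigroups generated by \<open>B + 3\<close>, \<open>B + 6\<close>, \<open>B + N + 2\<close> and \<open>B + N + 3\<close>\<close>

lemma generated_monoid_four: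
  "generated_monoid {p, q, s, t} = {a * p + b * q + c * s + d * t | a b c d. True}" (is "_ = ?T")
proof
  have "submonoid_nat ?T"
    unfolding submonoid_nat_def
  proof (intro conjI ballI)
    show "0 \<in> ?T" by force
    fix x y assume "x \<in> ?T" "y \<in> ?T"
    then obtain a b c d a' b' c' d' where
      "x = a * p + b * q + c * s + d * t" "y = a' * p + b' * q + c' * s + d' * t" by blast
    then have "x + y = (a + a') * p + (b + b') * q + (c + c') * s + (d + d') * t"
      by (simp add: algebra_simps)
    then show "x + y \<in> ?T" by blast
  qed
  moreover have "p = 1 * p + 0 * q + 0 * s + 0 * t" "q = 0 * p + 1 * q + 0 * s + 0 * t"
    "s = 0 * p + 0 * q + 1 * s + 0 * t" "t = 0 * p + 0 * q + 0 * s + 1 * t" by simp_all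
  then have "{p, q, s, t} \<subseteq> ?T" by blast
  ultimately show "generated_monoid {p, q, s, t} \<subseteq> ?T"
    unfolding generated_monoid_def by (intro hull_minimal)
  have M: "submonoid_nat (generated_monoid {p, q, s, t})" by (rule submonoid_generated_monoid)
  have "p \<in> generated_monoid {p, q, s, t}" "q \<in> generated_monoid {p, q, s, t}"
    "s \<in> generated_monoid {p, q, s, t}" "t \<in> generated_monoid {p, q, s, t}"
    using generators_subset[of "{p, q, s, t}"] by auto
  note this[THEN submonoid_nat_mult[OF M]]
  then have "a * p + b * q + c * s + d * t \<in> generated_monoid {p, q, s, t}" for a b c d
    using M by (simp add: submonoid_nat_def)
  then show "?T \<subseteq> generated_monoid {p, q, s, t}" by blast
qed

locale four_generators =
  fixes n r :: nat
  assumes n_ge: "2 \<le> n" and r_ge: "3 * n + 2 \<le> r"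
begin

definition N :: nat where "N = 3 * n + 2"

definition B :: nat where "B = r * N"

definition S :: "nat set" where
  "S = {(a + b + c + d) * B + (3 * a + 6 * b + c * (N + 2) + d * (N + 3)) | a b c d. True}"

lemma N_ge: "8 \<le> N" and N_le: "N \<le> r" and B_ge_r: "8 * r \<le> B" and B_ge_N: "N * N \<le> B"
proof -
  show "8 \<le> N" "N \<le> r" using n_ge r_ge by (auto simp: N_def)
  then show "8 * r \<le> B" "N * N \<le> B" by (simp_all add: B_def)
qed

lemma generated_eq:
  "generated_monoid {r * (3 * n + 2) + 3, r * (3 * n + 2) + 6, r * (3 * n + 2) + 3 * n + 4,
     r * (3 * n + 2) + 3 * n + 5} = S"
proof -
  have "a * (B + 3) + b * (B + 6) + c * (B + N + 2) + d * (B + N + 3)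
      = (a + b + c + d) * B + (3 * a + 6 * b + c * (N + 2) + d * (N + 3))" for a b c d
    by (simp add: algebra_simps)
  moreover have "r * (3 * n + 2) + 3 = B + 3" "r * (3 * n + 2) + 6 = B + 6"
    "r * (3 * n + 2) + 3 * n + 4 = B + N + 2" "r * (3 * n + 2) + 3 * n + 5 = B + N + 3"
    by (simp_all add: B_def N_def)
  ultimately show ?thesis by (simp only: generated_monoid_four S_def)
qed

lemma layer_memberI:
  assumes "a + b + c + d = j" "3 * a + 6 * b + c * (N + 2) + d * (N + 3) = e"
  shows "j * B + e \<in> S"
  using assms unfolding S_def by blast

text \<open>A number whose offset \<open>e\<close> from \<open>jB\<close> is below \<open>B\<close> and above the largest value that \<open>j - 1\<close>
  generators can reach is a sum of generators only if it is a sum of exactly \<open>j\<close> of them. The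
  gaps \<open>F\<close>, \<open>F - 1\<close> and \<open>f\<close> lie in such ranges.\<close>

lemma layer_memberE:
  assumes "j * B + e \<in> S" "e < B" "j * (N + 3) < B + e + (N + 3)"
  obtains a b c d where "a + b + c + d = j" "3 * a + 6 * b + c * (N + 2) + d * (N + 3) = e"
proof -
  obtain a b c d where x: "j * B + e
      = (a + b + c + d) * B + (3 * a + 6 * b + c * (N + 2) + d * (N + 3))"
    using assms(1) unfolding S_def by blast
  define s offset where "s = a + b + c + d" and "offset = 3 * a + 6 * b + c * (N + 2) + d * (N + 3)"
  have "a * 3 \<le> a * (N + 3)" "b * 6 \<le> b * (N + 3)" "c * (N + 2) \<le> c * (N + 3)"
    using N_ge by (intro mult_le_mono2; simp)+
  then have "offset \<le> a * (N + 3) + b * (N + 3) + c * (N + 3) + d * (N + 3)"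
    unfolding offset_def by linarith
  then have offset: "offset \<le> s * (N + 3)" by (simp add: s_def add_mult_distrib)
  have eq: "j * B + e = s * B + offset" using x by (simp add: s_def offset_def)
  have "s = j"
  proof (rule ccontr)
    assume "s \<noteq> j"
    then consider "Suc s \<le> j" | "Suc j \<le> s" by linarith
    then show False
    proof cases
      case 1
      then obtain k where j: "j = Suc s + k" using le_Suc_ex by blast
      have "offset = B + e + k * B" using eq by (simp add: j algebra_simps)
      moreover have "j * (N + 3) = s * (N + 3) + (N + 3) + k * (N + 3)" by (simp add: j algebra_simps)
      ultimately show False using offset assms(3) by linarith
    next
      case 2
      then have "Suc j * B \<le> s * B" by (rule mult_le_mono1)
      then show False using eq assms(2) by simp
    qed
  qed
  then show thesis using that eq by (simp add: s_def offset_def)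
qed

text \<open>This is \<open>(r + 1)(B + 3) + (N - 3)\<close>.\<close>

definition F :: nat where "F = (r + 1) * B + (N + 3 * r)"

text \<open>Over \<open>(r + 1)(B + 3)\<close> the excess is \<open>N - 3 = 3n - 1\<close> or \<open>N - 4 = 3n - 2\<close>, too small for a
  summand \<open>N - 1\<close> or \<open>N\<close> and not divisible by \<open>3\<close>.\<close>

lemma top_gaps:
  assumes "i \<in> {0, 1}"
  shows "(r + 1) * B + (N + 3 * r - i) \<notin> S"
proof
  assume "(r + 1) * B + (N + 3 * r - i) \<in> S"
  moreover have "N + 3 * r - i < B" using N_ge N_le B_ge_r by linarith
  moreover have "(r + 1) * (N + 3) < B + (N + 3 * r - i) + (N + 3)"
    using assms N_ge by (auto simp: B_def algebra_simps)
  ultimately obtain a b c d where abcd: "a + b + c + d = r + 1"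
    "3 * a + 6 * b + c * (N + 2) + d * (N + 3) = N + 3 * r - i"
    by (rule layer_memberE)
  have "c = 0"
  proof (cases c)
    case (Suc c')
    then have "c * (N + 2) = (N + 2) + c' * 3 + c' * (N - 1)" "d * (N + 3) = d * 3 + d * N"
      using N_ge by (auto simp: algebra_simps)
    then show ?thesis using abcd Suc by linarith
  qed
  moreover have "d = 0"
  proof (cases d)
    case (Suc d')
    then have "d * (N + 3) = (N + 3) + d' * 3 + d' * N" "c * (N + 2) = c * 3 + c * (N - 1)"
      using N_ge by (auto simp: algebra_simps)
    then show ?thesis using abcd Suc by linarith
  qed
  ultimately have "3 * a + 6 * b = N + 3 * r - i" "a + b = r + 1" using abcd by simp_all
  then show False using assms unfolding N_def by auto presburger+
qed

text \<open>Write \<open>e = qN + \<rho>\<close> with \<open>\<rho> < N\<close>. For \<open>q \<ge> 2\<close> there are two ways to produce the remainder.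
  If \<open>N - \<rho> \<le> q + 1\<close>, take \<open>q + 1\<close> copies of \<open>N\<close> and lower \<open>N - \<rho>\<close> of them to \<open>N - 1\<close>. Otherwise
  add \<open>\<lceil>\<rho>/3\<rceil>\<close> copies of \<open>3\<close> to \<open>q\<close> copies of \<open>N\<close> and lower up to two of the latter; then
  \<open>\<rho> \<le> N - q - 2\<close>, so at most \<open>q + (N - q)/3 \<le> N \<le> r\<close> summands are used. For \<open>q = 1\<close> and
  \<open>\<rho> \<equiv> 1\<close> modulo \<open>3\<close> two copies would have to be lowered, but then \<open>e\<close> is divisible by \<open>3\<close>.\<close>

lemma excess:
  assumes "3 * n \<le> e" "e \<le> B + N"
  obtains b c d where "b + c + d \<le> r + 1" "e = 3 * b + c * (N - 1) + d * N"
proof -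
  define q \<rho> where "q = e div N" and "\<rho> = e mod N"
  have e: "e = q * N + \<rho>" and \<rho>: "\<rho> < N"
    using N_ge by (simp_all add: q_def \<rho>_def)
  have q: "q \<le> r + 1" "q = r + 1 \<Longrightarrow> \<rho> = 0"
  proof -
    have "e \<le> (r + 1) * N" using assms(2) by (simp add: B_def)
    then have "e div N \<le> (r + 1) * N div N" by (rule div_le_mono)
    moreover have "(r + 1) * N div N = r + 1"
      using N_ge by (intro nonzero_mult_div_cancel_right) simp
    ultimately show "q \<le> r + 1" by (simp only: q_def)
    show "\<rho> = 0" if "q = r + 1" using \<open>e \<le> (r + 1) * N\<close> e that by simp
  qed
  have "q = 0 \<or> q = 1 \<or> 2 \<le> q" "\<rho> = 0 \<or> 0 < \<rho>" "N - \<rho> \<le> q + 1 \<or> q + 1 < N - \<rho>"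
    "\<rho> mod 3 = 0 \<or> \<rho> mod 3 = 1 \<or> \<rho> mod 3 = 2"
    by linarith+
  then consider "q = 0" | "q = 1" "\<rho> mod 3 = 0" | "q = 1" "\<rho> mod 3 = 2" | "q = 1" "\<rho> mod 3 = 1"
    | "2 \<le> q" "\<rho> = 0" | "2 \<le> q" "0 < \<rho>" "N - \<rho> \<le> q + 1" | "2 \<le> q" "q + 1 < N - \<rho>"
    by metis
  then show thesis
  proof cases
    case 1
    then have "e = 3 * n \<or> e = 3 * n + 1" using e \<rho> assms(1) by (auto simp: N_def)
    then show thesis using that[of n 0 0] that[of 0 1 0] r_ge by (auto simp: N_def)
  next
    case 2
    then show thesis using that[of "\<rho> div 3" 0 1] e \<rho> N_le by (auto simp: algebra_simps)
  next
    case 3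
    then have "\<rho> = 3 * (\<rho> div 3) + 2" by presburger
    then show thesis using that[of "\<rho> div 3 + 1" 1 0] 3 e \<rho> N_le N_ge by auto
  next
    case 4
    then have "e = 3 * (n + 1 + \<rho> div 3)" using e unfolding N_def by presburger
    then show thesis using that[of "n + 1 + \<rho> div 3" 0 0] \<rho> r_ge by (auto simp: N_def)
  next
    case 5
    then show thesis using that[of 0 0 q] e q by simp
  next
    case 6
    then obtain d where d: "q + 1 = N - \<rho> + d" using le_Suc_ex by blast
    have "k * N = k * (N - 1) + k" for k using N_ge by (cases N) auto
    then have "(q + 1) * N = (N - \<rho>) * (N - 1) + (N - \<rho>) + d * N"
      unfolding d add_mult_distrib by simp
    then have "e = 3 * 0 + (N - \<rho>) * (N - 1) + d * N" using e \<rho> by simp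
    moreover have "q \<le> r" using q 6 by force
    ultimately show thesis using that[of 0 "N - \<rho>" d] d by simp
  next
    case 7
    define b c where "b = (\<rho> + 2) div 3" and "c = 3 * b - \<rho>"
    have bc: "3 * b = \<rho> + c" "c \<le> 2" unfolding b_def c_def by presburger+
    then obtain d where d: "q = c + d" using 7 le_Suc_ex order_trans by metis
    have "c * N = c * (N - 1) + c" using N_ge by (cases N) auto
    then have "e = 3 * b + c * (N - 1) + d * N"
      using e bc by (simp add: d add_mult_distrib)
    moreover have "b + c + d \<le> r + 1" using bc 7 N_le d by linarith
    ultimately show thesis using that by blast
  qed
qed

text \<open>\<open>x\<close> is put into the layer \<open>j\<close> for which its excess over \<open>j(B + 3)\<close> lies in
  \<open>[3n, 3n + B + 2]\<close>. This interval has length \<open>B + 3\<close> and starts at the first excess beyond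
  \<open>N - 3\<close>, so \<open>j \<ge> r + 1\<close>.\<close>

lemma above_F:
  assumes "F < x"
  shows "x \<in> S"
proof -
  define y where "y = x - 3 * n"
  define j u where "j = y div (B + 3)" and "u = y mod (B + 3)"
  have x: "x = j * (B + 3) + (u + 3 * n)" and "u \<le> B + 2" and "r + 1 \<le> j"
  proof -
    have "y = j * (B + 3) + u" unfolding j_def u_def by (simp only: div_mult_mod_eq)
    moreover have "(r + 1) * (B + 3) + 3 * n \<le> x" using assms by (simp add: F_def N_def algebra_simps)
    then have "(r + 1) * (B + 3) \<le> y" "x = y + 3 * n" by (simp_all add: y_def)
    ultimately show "x = j * (B + 3) + (u + 3 * n)" "r + 1 \<le> j"
      unfolding j_def by (simp_all add: less_eq_div_iff_mult_less_eq)
    have "u < B + 3" by (simp add: u_def)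
    then show "u \<le> B + 2" by simp
  qed
  obtain b c d where bcd: "b + c + d \<le> r + 1" "u + 3 * n = 3 * b + c * (N - 1) + d * N"
    using excess[of "u + 3 * n"] \<open>u \<le> B + 2\<close> by (auto simp: N_def)
  then obtain a where a: "j = a + b + c + d"
    using \<open>r + 1 \<le> j\<close> le_Suc_ex[of "b + c + d" j] by (auto simp: algebra_simps)
  have "c * (N - 1) + 3 * c = c * (N + 2)" using N_ge by (cases N) (auto simp: algebra_simps)
  then have "3 * a + 6 * b + c * (N + 2) + d * (N + 3) = 3 * j + (u + 3 * n)"
    unfolding bcd(2) by (simp add: a algebra_simps)
  then have "j * B + (3 * j + (u + 3 * n)) \<in> S" using a by (intro layer_memberI) auto
  then show ?thesis unfolding x by (simp add: algebra_simps)
qed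

lemma submonoid: "submonoid_nat S"
  unfolding generated_eq[symmetric] by (rule submonoid_generated_monoid)

lemma multiplicity: "multiplicity_sg S = B + 3"
  unfolding multiplicity_sg_def
proof (rule Least_equality)
  show "B + 3 \<in> S \<and> B + 3 \<noteq> 0" using layer_memberI[of 1 0 0 0 1 3] by simp
  fix x assume "x \<in> S \<and> x \<noteq> 0"
  then have "x \<in> S" "x \<noteq> 0" by simp_all
  from \<open>x \<in> S\<close> obtain a b c d
    where x: "x = (a + b + c + d) * B + (3 * a + 6 * b + c * (N + 2) + d * (N + 3))"
    unfolding S_def by blast
  then have "1 \<le> a + b + c + d" using \<open>x \<noteq> 0\<close> by (cases "a + b + c + d") auto
  then have "1 * B \<le> (a + b + c + d) * B" by (rule mult_le_mono1)
  moreover have "c * 3 \<le> c * (N + 2)" "d * 3 \<le> d * (N + 3)"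
    using N_ge by (intro mult_le_mono2; simp)+
  ultimately show "B + 3 \<le> x" unfolding x using \<open>1 \<le> a + b + c + d\<close> by linarith
qed

definition f :: nat where "f = (n + 1) * B + (4 * N - 3)"

text \<open>Among \<open>n + 1\<close> generators the last two must occur \<open>c + d < 4\<close> times in total. If \<open>c + d \<le> 1\<close>,
  the offset is too small, and for \<open>c + d = 2, 3\<close> the residue modulo \<open>3\<close> determines \<open>c\<close> and leaves
  no solution for the multiplicities of the first two.\<close>

lemma f_notin: "f \<notin> S"
proof
  have B: "4 * N \<le> B" using B_ge_N mult_le_mono1[OF N_ge, of N] by linarith
  assume "f \<in> S"
  then have "(n + 1) * B + (4 * N - 3) \<in> S" by (simp add: f_def)
  moreover have "4 * N - 3 < B" using B N_ge by linarith
  moreover have "(n + 1) * (N + 3) < B + (4 * N - 3) + (N + 3)"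
  proof -
    have "n * N \<le> N * N" by (simp add: N_def)
    then show ?thesis using B_ge_N N_ge by (simp add: N_def algebra_simps)
  qed
  ultimately obtain a b c d where abcd: "a + b + c + d = n + 1"
    "3 * a + 6 * b + c * (N + 2) + d * (N + 3) = 4 * N - 3"
    by (rule layer_memberE)
  have sum: "3 * a + 6 * b + 2 * c + 3 * d + (c + d) * N = 4 * N - 3"
    using abcd(2) by (simp add: algebra_simps)
  have "c + d < 4"
  proof (rule ccontr)
    assume "\<not> ?thesis"
    then have "4 * N \<le> (c + d) * N" by (intro mult_le_mono1) simp
    then show False using sum N_ge by linarith
  qed
  then have "c \<in> {0, 1, 2, 3} \<and> d \<in> {0, 1, 2, 3}" by auto
  then consider "c = 0" "d = 0" | "c = 1" "d = 0" | "c = 0" "d = 1" | "c = 2" "d = 0"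
    | "c = 1" "d = 1" | "c = 0" "d = 2" | "c = 3" "d = 0" | "c = 2" "d = 1" | "c = 1" "d = 2"
    | "c = 0" "d = 3"
    using \<open>c + d < 4\<close> by auto
  moreover have "3 * a + 6 * b + 2 * c + 3 * d + (c + d) * (3 * n + 2) = 12 * n + 5"
    using sum by (simp add: N_def)
  ultimately show False
    using abcd(1) n_ge by cases ((simp; fail) | (simp; linarith) | (simp; presburger))+
qed

text \<open>The offsets \<open>4N\<close>, \<open>4N + 3\<close>, \<open>5N - 1\<close>, \<open>5N\<close> of the four sums from \<open>(n + 2)B\<close> decompose as
  \<open>6n + 2(N + 2)\<close>, \<open>3(n - 1) + (N + 2) + 2(N + 3)\<close>, \<open>6(n - 1) + 3(N + 3)\<close> and
  \<open>3(n - 2) + 4(N + 2)\<close>.\<close>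

lemma f_add_generators:
  "f + (B + 3) \<in> S" "f + (B + 6) \<in> S" "f + (B + N + 2) \<in> S" "f + (B + N + 3) \<in> S"
proof -
  have "(n + 2) * B + 4 * N \<in> S"
    by (rule layer_memberI[of 0 n 2 0]) (auto simp: N_def)
  then show "f + (B + 3) \<in> S" using N_ge by (simp add: f_def algebra_simps)
  have "(n + 2) * B + (4 * N + 3) \<in> S"
    using n_ge by (intro layer_memberI[of "n - 1" 0 1 2]) (auto simp: N_def)
  then show "f + (B + 6) \<in> S" using N_ge by (simp add: f_def algebra_simps)
  have "(n + 2) * B + (5 * N - 1) \<in> S"
    using n_ge by (intro layer_memberI[of 0 "n - 1" 0 3]) (auto simp: N_def)
  moreover have "f + (B + N + 2) = (n + 2) * B + (5 * N - 1)"
    by (simp add: f_def N_def add_mult_distrib)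
  ultimately show "f + (B + N + 2) \<in> S" by (simp only:)
  have "(n + 2) * B + 5 * N \<in> S"
    using n_ge by (intro layer_memberI[of "n - 2" 0 4 0]) (auto simp: N_def)
  then show "f + (B + N + 3) \<in> S" using N_ge by (simp add: f_def algebra_simps)
qed

lemma f_add:
  assumes "s \<in> S" "s \<noteq> 0"
  shows "f + s \<in> S"
proof -
  let ?G = "{B + 3, B + 6, B + N + 2, B + N + 3}"
  have add: "x + y \<in> S" if "x \<in> S" "y \<in> S" for x y
    using submonoid that by (simp add: submonoid_nat_def)
  have mem: "a * (B + 3) + b * (B + 6) + c * (B + N + 2) + d * (B + N + 3) \<in> S" for a b c d
    using layer_memberI[OF refl refl, of a b c d] by (simp add: algebra_simps)
  obtain a b c d where "s = (a + b + c + d) * B + (3 * a + 6 * b + c * (N + 2) + d * (N + 3))"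
    using assms(1) unfolding S_def by blast
  then have s: "s = a * (B + 3) + b * (B + 6) + c * (B + N + 2) + d * (B + N + 3)"
    by (simp add: algebra_simps)
  then consider a' where "a = Suc a'" | b' where "b = Suc b'" | c' where "c = Suc c'"
    | d' where "d = Suc d'"
    using assms(2) by (cases a; cases b; cases c; cases d) auto
  then obtain g h where "g \<in> ?G" "s = g + h" "h \<in> S"
  proof cases
    case 1
    then show thesis using that[OF _ _ mem[of a' b c d], of "B + 3"] s by simp
  next
    case 2
    then show thesis using that[OF _ _ mem[of a b' c d], of "B + 6"] s by simp
  next
    case 3
    then show thesis using that[OF _ _ mem[of a b c' d], of "B + N + 2"] s by simp
  next
    case 4
    then show thesis using that[OF _ _ mem[of a b c d'], of "B + N + 3"] s by simp
  qed
  then have "f + g \<in> S" using f_add_generators by blast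
  then show ?thesis using add[of "f + g" h] \<open>s = g + h\<close> \<open>h \<in> S\<close> by (simp add: add.assoc)
qed

sublocale proper_numerical_semigroup S F
proof
  show "F \<notin> S" using top_gaps[of 0] by (simp add: F_def)
qed (use submonoid above_F in auto)

lemma f_pseudo_Frobenius: "f \<in> pseudo_Frobenius"
  using f_notin f_add by (auto simp: pseudo_Frobenius_def)

lemma f_small: "f + (B + 3) \<le> F"
proof -
  have "(n + 3) * B \<le> (r + 1) * B" using r_ge by (intro mult_le_mono1) simp
  moreover have "f + (B + 3) = (n + 2) * B + 4 * N" using N_ge by (simp add: f_def algebra_simps)
  moreover have "8 * N \<le> B" using B_ge_N mult_le_mono1[OF N_ge, of N] by linarith
  ultimately show ?thesis by (simp add: F_def algebra_simps)
qed

theorem neither: "\<not> maximal_reduced_type TYPE('k::field) S \<and> \<not> minimal_reduced_type TYPE('k) S"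
proof
  show "\<not> maximal_reduced_type TYPE('k) S"
    by (rule not_maximal_reduced_type[OF f_pseudo_Frobenius]) (simp only: multiplicity f_small)
  have "F - 1 \<notin> S" using top_gaps[of 1] N_ge by (simp add: F_def)
  then show "\<not> minimal_reduced_type TYPE('k) S"
    using F_pos multiplicity by (intro not_minimal_reduced_type[of "F - 1"]) auto
qed

end

theorem proposition3p6:
  fixes n r n1 n2 n3 n4 :: nat and S :: "nat set"
  assumes "n \<ge> 2" and "r \<ge> 3 * n + 2"
    and "n1 = r * (3 * n + 2) + 3"
    and "n2 = r * (3 * n + 2) + 6"
    and "n3 = r * (3 * n + 2) + 3 * n + 4"
    and "n4 = r * (3 * n + 2) + 3 * n + 5"
    and "S = generated_monoid {n1, n2, n3, n4}"
  shows "\<not> maximal_reduced_type TYPE('k::{alg_closed_field, field_char_0}) S \<and>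
         \<not> minimal_reduced_type TYPE('k) S"
proof -
  interpret four_generators n r using assms(1,2) by unfold_locales
  show ?thesis unfolding assms(3-7) generated_eq by (rule neither)
qed

end
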